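(* Let a strict complete stable marriage instance of size $n$ be given, with set of men $M$, set of women $W$ and rank-complement matrices $A,B$. For every nonempty $S_w\subseteq W$ and every man $i$, $|C_i(S_w)|=\alpha_i$, and $C_i(S_w)$ is the maximal suffix of $i$'s preference list contained in $T_w=W\setminus S_w$: reading upward from his worst woman, it consists precisely of the women encountered before the first member of $S_w$. Symmetrically, for every nonempty $S_m\subseteq M$ and every woman $j$, $|D_j(S_m)|=\delta_j$, and $D_j(S_m)$ is the maximal suffix of $j$'s preference list contained in $T_m=M\setminus S_m$: reading upward from her worst man, it consists precisely of the men encountered before the first member of $S_m$.
   Context: In an instance of size $n$ there are $n$ men and $n$ women, each with a strict complete preference order on the other side; $r_M(i,j)\in\{1,\dots,n\}$ is the rank of woman $j$ in man $i$'s list and $r_W(j,i)\in\{1,\dots,n\}$ the rank of man $i$ in woman $j$'s list (1 is best). The rank-complement matrices are $A_{ij}=n-r_M(i,j)$ and $B_{ij}=n-r_W(j,i)$. Preference lists are written from best to worst. For nonempty $S_w\subseteq W$ put $T_w=W\setminus S_w$, $\alpha_i=\min_{j\in S_w}A_{ij}$ and $C_i(S_w)=\{w\in T_w: A_{iw}<\alpha_i\}$. For nonempty $S_m\subseteq M$ put $T_m=M\setminus S_m$, $\delta_j=\min_{i\in S_m}B_{ij}$ and $D_j(S_m)=\{i\in T_m: B_{ij}<\delta_j\}$. *)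

theory Defs
  imports "HOL-Library.Sublist"
begin

text \<open>
  A strict complete instance of size \<open>n\<close>: \<open>PM i\<close> is man \<open>i\<close>'s list of all women and \<open>PW j\<close> is
  woman \<open>j\<close>'s list of all men, both written from best to worst. A strict complete order on a
  finite set is a list enumerating it without repetition.
\<close>

definition sm_instance ::
  "nat \<Rightarrow> 'm set \<Rightarrow> 'w set \<Rightarrow> ('m \<Rightarrow> 'w list) \<Rightarrow> ('w \<Rightarrow> 'm list) \<Rightarrow> bool" where
  "sm_instance n M W PM PW \<longleftrightarrow>
     finite M \<and> card M = n \<and> finite W \<and> card W = n \<and>
     (\<forall>i\<in>M. distinct (PM i) \<and> set (PM i) = W) \<and>
     (\<forall>j\<in>W. distinct (PW j) \<and> set (PW j) = M)"

text \<open>One-based position; only meaningful for a member of a repetition-free list.\<close>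

definition pref_rank :: "'a list \<Rightarrow> 'a \<Rightarrow> nat" where
  "pref_rank xs x = Suc (THE k. k < length xs \<and> xs ! k = x)"

text \<open>
  Both matrices have rows indexed by men and columns by women. The subtractions do not truncate
  in an instance of size \<open>n\<close>, since all ranks of members then lie in \<open>{1..n}\<close>.
\<close>

definition rcA :: "nat \<Rightarrow> ('m \<Rightarrow> 'w list) \<Rightarrow> 'm \<Rightarrow> 'w \<Rightarrow> nat" where
  "rcA n PM i j = n - pref_rank (PM i) j"

definition rcB :: "nat \<Rightarrow> ('w \<Rightarrow> 'm list) \<Rightarrow> 'm \<Rightarrow> 'w \<Rightarrow> nat" where
  "rcB n PW i j = n - pref_rank (PW j) i"

text \<open>
  The index set \<open>S\<close> of the minimum is always finite and nonempty where these are used. The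
  matrices \<open>A\<close>, \<open>B\<close> are passed as arguments.
\<close>

definition alpha :: "('m \<Rightarrow> 'w \<Rightarrow> nat) \<Rightarrow> 'w set \<Rightarrow> 'm \<Rightarrow> nat" where
  "alpha A S i = Min ((\<lambda>j. A i j) ` S)"

definition C_set :: "('m \<Rightarrow> 'w \<Rightarrow> nat) \<Rightarrow> 'w set \<Rightarrow> 'w set \<Rightarrow> 'm \<Rightarrow> 'w set" where
  "C_set A W S i = {w \<in> W - S. A i w < alpha A S i}"

definition delta :: "('m \<Rightarrow> 'w \<Rightarrow> nat) \<Rightarrow> 'm set \<Rightarrow> 'w \<Rightarrow> nat" where
  "delta B S j = Min ((\<lambda>i. B i j) ` S)"

definition D_set :: "('m \<Rightarrow> 'w \<Rightarrow> nat) \<Rightarrow> 'm set \<Rightarrow> 'm set \<Rightarrow> 'w \<Rightarrow> 'm set" where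
  "D_set B M S j = {i \<in> M - S. B i j < delta B S j}"

text \<open>
  \<open>ys\<close> is the greatest suffix of \<open>xs\<close> with all entries in \<open>T\<close>; suffixes of a list form a chain,
  so greatest and maximal coincide, and such a \<open>ys\<close> is unique.
\<close>

definition maximal_suffix_in :: "'a set \<Rightarrow> 'a list \<Rightarrow> 'a list \<Rightarrow> bool" where
  "maximal_suffix_in T xs ys \<longleftrightarrow>
     suffix ys xs \<and> set ys \<subseteq> T \<and>
     (\<forall>zs. suffix zs xs \<and> set zs \<subseteq> T \<longrightarrow> suffix zs ys)"

text \<open>The entries met when reading \<open>xs\<close> from its last entry upward, before the first member of \<open>S\<close>.\<close>

definition met_before :: "'a set \<Rightarrow> 'a list \<Rightarrow> 'a set" where
  "met_before S xs = set (takeWhile (\<lambda>x. x \<notin> S) (rev xs))"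

end

theory Submission
  imports Defs
begin

text \<open>
  In the reversed list, the rank complement of an entry is its zero-based index. So the minimum
  of the rank complements over \<open>S\<close> is the index of the first member of \<open>S\<close>, which is the
  length of the prefix before it.
\<close>

lemma pref_rank_nth:
  assumes "distinct xs" "k < length xs"
  shows "pref_rank xs (xs ! k) = Suc k"
proof -
  have "(THE l. l < length xs \<and> xs ! l = xs ! k) = k"
    using assms by (intro the_equality) (auto simp: nth_eq_iff_index_eq)
  then show ?thesis
    by (simp add: pref_rank_def)
qed

text \<open>Index \<open>k\<close> of \<open>rev xs\<close> is index
  \<open>length xs - Suc k\<close> of \<open>xs\<close>, hence rank \<open>length xs - k\<close>:
  counting from zero at the back offsets counting from one at the front.\<close>

lemma rank_complement_rev_nth:
  assumes "distinct xs" "k < length xs"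
  shows "length xs - pref_rank xs (rev xs ! k) = k"
  using assms by (simp add: rev_nth pref_rank_nth)

lemma prefix_takeWhile:
  assumes "prefix zs xs" "\<And>x. x \<in> set zs \<Longrightarrow> P x"
  shows "prefix zs (takeWhile P xs)"
  using assms by (auto simp: prefix_def)

text \<open>Reversal turns suffixes into prefixes, and a prefix of \<open>rev xs\<close> that avoids
  \<open>S\<close> cannot extend past the point where \<open>takeWhile\<close> stops.\<close>

lemma maximal_suffix_in_rev_takeWhile:
  "maximal_suffix_in (set xs - S) xs (rev (takeWhile (\<lambda>x. x \<notin> S) (rev xs)))"
  unfolding maximal_suffix_in_def
  by (auto simp: suffix_to_prefix takeWhile_is_prefix
      intro!: prefix_takeWhile dest: set_takeWhileD)

lemma Min_rank_complement:
  assumes "distinct xs" "S \<subseteq> set xs" "S \<noteq> {}"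
  shows "Min ((\<lambda>x. length xs - pref_rank xs x) ` S) = length (takeWhile (\<lambda>x. x \<notin> S) (rev xs))"
    (is "Min (?f ` S) = ?m")
proof (rule Min_eqI)
  show "finite (?f ` S)"
    using assms(2) by (simp add: finite_subset)
  \<comment> \<open>Since \<open>S\<close> meets \<open>xs\<close>, the scan stops inside the list.
    So \<open>?m\<close> is a valid index, and the entry there lies in \<open>S\<close> and attains
    the value \<open>?m\<close>.\<close>
  have "takeWhile (\<lambda>x. x \<notin> S) (rev xs) \<noteq> rev xs"
    using assms(2,3) by (auto simp: takeWhile_eq_all_conv)
  then have m: "?m < length xs"
    using takeWhile_is_prefix[of "\<lambda>x. x \<notin> S" "rev xs"]
    by (metis length_rev length_takeWhile_le linorder_le_less_linear nle_le
        takeWhile_eq_take take_all)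
  then have "rev xs ! ?m \<in> S"
    using nth_length_takeWhile[of "\<lambda>x. x \<notin> S" "rev xs"] by simp
  then show "?m \<in> ?f ` S"
    using rank_complement_rev_nth[OF assms(1) m] by force
next
  fix y assume "y \<in> ?f ` S"
  then obtain x where x: "x \<in> S" "y = ?f x"
    by blast
  then obtain k where k: "k < length xs" "rev xs ! k = x"
    using assms(2) by (metis in_set_conv_nth length_rev set_rev subsetD)
  have "y = k"
    using x k rank_complement_rev_nth[OF assms(1) k(1)] by simp
  \<comment> \<open>An index below \<open>?m\<close> would place \<open>x\<close> in the scanned
    prefix, all of whose entries avoid \<open>S\<close>.\<close>
  moreover have "\<not> k < ?m"
    using nth_mem[of k "takeWhile (\<lambda>x. x \<notin> S) (rev xs)"] x k
    by (metis set_takeWhileD takeWhile_nth)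
  ultimately show "?m \<le> y"
    by simp
qed

text \<open>With the minimum known to be the length of the scanned prefix, the inequality compares
  indices: by distinctness an entry has one index in \<open>rev xs\<close>, and it lies in the
  prefix exactly when that index is below this length.\<close>

lemma rank_complement_less_Min_iff:
  assumes "distinct xs" "S \<subseteq> set xs" "S \<noteq> {}"
  shows "{x \<in> set xs - S. length xs - pref_rank xs x
            < Min ((\<lambda>x. length xs - pref_rank xs x) ` S)} = met_before S xs"
    (is "?L = _")
proof -
  let ?t = "takeWhile (\<lambda>x. x \<notin> S) (rev xs)"
  note m = Min_rank_complement[OF assms]
  note f = rank_complement_rev_nth[OF assms(1)]
  have len: "length ?t \<le> length xs"
    by (metis length_rev length_takeWhile_le)
  show ?thesis
    unfolding met_before_def m
  proof (intro set_eqI iffI)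
    fix x assume "x \<in> {x \<in> set xs - S. length xs - pref_rank xs x < length ?t}"
    then have x: "x \<in> set xs" "length xs - pref_rank xs x < length ?t"
      by auto
    then obtain k where k: "k < length xs" "rev xs ! k = x"
      by (metis in_set_conv_nth length_rev set_rev)
    then have "k < length ?t"
      using x f[OF k(1)] by simp
    then show "x \<in> set ?t"
      using k(2) by (metis nth_mem takeWhile_nth)
  next
    fix x assume t: "x \<in> set ?t"
    then obtain k where k: "k < length ?t" "rev xs ! k = x"
      by (metis in_set_conv_nth takeWhile_nth)
    then have "length xs - pref_rank xs x = k"
      using f[of k] len by simp
    then show "x \<in> {x \<in> set xs - S. length xs - pref_rank xs x < length ?t}"
      using t k(1) by (auto dest: set_takeWhileD)
  qed
qed

text \<open>A single list, with \<open>length xs\<close> as the instance size, covers a man's row of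
  \<open>A\<close> and a woman's column of \<open>B\<close> alike.\<close>

lemma rank_complement_suffix:
  fixes xs :: "'a list"
  assumes "distinct xs" "S \<subseteq> set xs" "S \<noteq> {}"
  defines "f \<equiv> \<lambda>x. length xs - pref_rank xs x"
  defines "X \<equiv> {x \<in> set xs - S. f x < Min (f ` S)}"
  shows "card X = Min (f ` S)"
    and "\<exists>ys. maximal_suffix_in (set xs - S) xs ys \<and> X = set ys"
    and "X = met_before S xs"
proof -
  show X: "X = met_before S xs"
    unfolding X_def f_def using assms(1-3) by (rule rank_complement_less_Min_iff)
  show "card X = Min (f ` S)"
    unfolding X f_def Min_rank_complement[OF assms(1-3)] met_before_def
    using assms(1) by (simp add: distinct_card distinct_takeWhile)
  \<comment> \<open>The witness is the scanned prefix turned back into list order, which leaves its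
    set of entries unchanged.\<close>
  show "\<exists>ys. maximal_suffix_in (set xs - S) xs ys \<and> X = set ys"
    using maximal_suffix_in_rev_takeWhile[of xs S] X
    by (auto simp: met_before_def intro!: exI)
qed

theorem lemma6p2:
  fixes n :: nat
    and M :: "'m set" and W :: "'w set"
    and PM :: "'m \<Rightarrow> 'w list" and PW :: "'w \<Rightarrow> 'm list"
    and A B :: "'m \<Rightarrow> 'w \<Rightarrow> nat"
  assumes "sm_instance n M W PM PW"
    and "A = rcA n PM" and "B = rcB n PW"
  shows "(\<forall>S i. S \<subseteq> W \<and> S \<noteq> {} \<and> i \<in> M \<longrightarrow>
            card (C_set A W S i) = alpha A S i \<and>
            (\<exists>ys. maximal_suffix_in (W - S) (PM i) ys \<and> C_set A W S i = set ys) \<and>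
            C_set A W S i = met_before S (PM i)) \<and>
         (\<forall>S j. S \<subseteq> M \<and> S \<noteq> {} \<and> j \<in> W \<longrightarrow>
            card (D_set B M S j) = delta B S j \<and>
            (\<exists>ys. maximal_suffix_in (M - S) (PW j) ys \<and> D_set B M S j = set ys) \<and>
            D_set B M S j = met_before S (PW j))"
proof (rule conjI; intro allI impI; elim conjE)
  fix S i assume S: "S \<subseteq> W" "S \<noteq> {}" and "i \<in> M"
  \<comment> \<open>\<open>distinct_card\<close> gives \<open>length (PM i) = card W = n\<close>, so
    \<open>rcA\<close> agrees with the complement taken in
    \<open>rank_complement_suffix\<close>.\<close>
  then have i: "distinct (PM i)" "set (PM i) = W" "length (PM i) = n"
    using assms(1) distinct_card[of "PM i"] by (auto simp: sm_instance_def)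
  show "card (C_set A W S i) = alpha A S i \<and>
      (\<exists>ys. maximal_suffix_in (W - S) (PM i) ys \<and> C_set A W S i = set ys) \<and>
      C_set A W S i = met_before S (PM i)"
    using rank_complement_suffix[of "PM i" S] S
    by (simp add: i C_set_def alpha_def assms(2) rcA_def)
next
  fix S j assume S: "S \<subseteq> M" "S \<noteq> {}" and "j \<in> W"
  then have j: "distinct (PW j)" "set (PW j) = M" "length (PW j) = n"
    using assms(1) distinct_card[of "PW j"] by (auto simp: sm_instance_def)
  show "card (D_set B M S j) = delta B S j \<and>
      (\<exists>ys. maximal_suffix_in (M - S) (PW j) ys \<and> D_set B M S j = set ys) \<and>
      D_set B M S j = met_before S (PW j)"
    using rank_complement_suffix[of "PW j" S] S
    by (simp add: j D_set_def delta_def assms(3) rcB_def)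
qed

end
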